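(* In the smart-contract blockchain model (with either the DFS or the BFS execution order), a blockchain equipped with both mechanisms $\mathtt{first}$ and $\mathtt{fail}$ implements transaction monitors.
   Context: Blockchain model. A configuration is a pair $(\Sigma,\Delta)$: $\Sigma$ is a partial map from addresses to the storage ($st$) and balance of smart contracts, and $\Delta$ is a context with additional information (block number, time, etc.). An operation $o$ is a record with fields $dest$ (invoked address), $src$ (source address), $param$ (parameters) and $money$ (amount sent). A smart contract is a deterministic partial map $A:\Delta\times P\times S\times\mathbb{N}\rightharpoonup S\times[\mathcal{O}]$ taking context, parameters, current storage and balance to a new storage and a list of new operations; undefined means failure. A fixed partial map $\mathbb{G}$ assigns contracts to addresses. Executing $o$ from $(\Sigma,\Delta)$ succeeds iff the balance of $o.src$ is at least $o.money$ and $\mathbb{G}(o.dest)(\Delta,o.param,\Sigma(o.dest).st,\Sigma(o.dest).balance)=(st',ls)$ is defined; then $o.money$ is moved from $o.src$ to $o.dest$, the storage of $o.dest$ becomes $st'$, and the new operations $ls$ are emitted. A transaction starts with pending list $[o]$, $o$ an external operation, and repeatedly executes the head $o$ of the pending list $o::os$; the new pending list is $ls \mathbin{+\!\!+} os$ (DFS) or $os \mathbin{+\!\!+} ls$ (BFS). If an operation fails, the transaction fails and the state is unchanged; if the pending list becomes empty, the transaction commits. Gas consumption is disregarded: there is always sufficient gas for finite executions. Mechanisms. - $\mathtt{first}$: an instruction returning true iff the current operation is the first invocation of the executing contract in the current transaction. - $\mathtt{fail}$: each contract has a flag $\mathtt{fail}$, false by default, that can be assigned during the execution of the contract; at the end of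 the transaction the whole transaction fails if some contract has its flag set to true. Transaction monitors. A monitored smart contract is a contract $A$ together with a private monitor storage and four functions $A_{init},A_{begin},A_{end},A_{term}$, which cannot emit operations or modify the contract storage, but can fail, in which case the whole transaction fails. $A_{init}$ runs before the first invocation of $A$ in a transaction; it reads the storage and balance of $A$ and reads and writes the monitor storage. $A_{begin}$ runs before each operation executed in $A$, with the operation's arguments and the monitor storage, which it may modify. $A_{end}$ runs after each operation executed in $A$, with the operation's result (emitted operations and new storage) and the monitor storage, which it may modify. $A_{term}$ runs at the end of the transaction (when the pending list is empty) for each contract $A$ visited in the transaction; it reads the storage and balance of $A$ and the monitor storage, without modifying the latter. If none of these functions fails, the effect on the blockchain is the same as without monitors. Implementation. A blockchain equipped with given mechanisms implements transaction monitors iff it can write every monitored smart contract; i.e. for each monitored contract there is an unmonitored contract written using the given mechanisms (possibly with auxiliary storage fields) that can replace it, with the same transactions failing or committing and the same behaviour of the contract.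
   Formalization: Contracts also see the amount sent along with the parameters, emitted operations have the emitting contract as source, and external operations come from addresses without a contract; otherwise the final balance read by A_term cannot be determined by the replacement and the claim fails. *)

theory Defs
  imports "HOL-Library.Monad_Syntax"
begin

record ('a, 'p) operation =
  dest  :: 'a
  src   :: 'a
  param :: 'p
  money :: nat

text \<open>
  Storages of all contracts live in one type \<^typ>\<open>'s\<close>. The auxiliary storage
  fields \<open>aux\<close> are extra storage of an unmonitored contract; the private
  monitor storage \<open>mon\<close> belongs to a monitored contract. External users have
  an account (hence a balance) too, but no contract is assigned to their address.
\<close>

record ('s, 'x, 'm) account =
  st      :: 's
  aux     :: 'x
  mon     :: 'm
  balance :: nat

type_synonym ('a, 's, 'x, 'm) ledger = "'a \<rightharpoonup> ('s, 'x, 'm) account"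

text \<open>
  The arguments with which an operation invokes a contract are its parameters
  together with the amount sent. The balance passed to a contract is the one
  before the transfer, so the amount is not otherwise observable during the
  invocation.
\<close>

type_synonym 'p args = "'p \<times> nat"

definition args :: "('a, 'p) operation \<Rightarrow> 'p args" where
  "args o1 = (param o1, money o1)"

type_synonym ('c, 'p, 's, 'a) contract =
  "'c \<Rightarrow> 'p args \<Rightarrow> 's \<Rightarrow> nat \<Rightarrow> ('s \<times> ('a, 'p) operation list) option"

text \<open>
  A contract using \<open>first\<close> and \<open>fail\<close>: the additional argument is the value of
  the instruction \<open>first\<close>; the additional result is the assignment made to the
  flag \<open>fail\<close>, with \<^const>\<open>None\<close> if the flag is not assigned.
\<close>

type_synonym ('c, 'p, 's, 'a) first_fail_contract =
  "'c \<Rightarrow> 'p args \<Rightarrow> 's \<Rightarrow> nat \<Rightarrow> bool \<Rightarrow>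
     ('s \<times> ('a, 'p) operation list \<times> bool option) option"

text \<open>
  Monitor functions fail by returning \<^const>\<open>None\<close>, or \<^const>\<open>False\<close>
  in the case of \<open>m_term\<close>, which has no other result.
\<close>

record ('c, 'p, 's, 'm, 'a) monitored_contract =
  code    :: "('c, 'p, 's, 'a) contract"
  m_init  :: "'s \<Rightarrow> nat \<Rightarrow> 'm \<Rightarrow> 'm option"
  m_begin :: "'p args \<Rightarrow> 'm \<Rightarrow> 'm option"
  m_end   :: "('a, 'p) operation list \<Rightarrow> 's \<Rightarrow> 'm \<Rightarrow> 'm option"
  m_term  :: "'s \<Rightarrow> nat \<Rightarrow> 'm \<Rightarrow> bool"

datatype ('c, 'p, 's, 'x, 'm, 'a) any_contract =
    Unmonitored "('c, 'p, 's \<times> 'x, 'a) first_fail_contract"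
  | Monitored "('c, 'p, 's, 'm, 'a) monitored_contract"

type_synonym ('c, 'p, 's, 'x, 'm, 'a) network =
  "'a \<rightharpoonup> ('c, 'p, 's, 'x, 'm, 'a) any_contract"

text \<open>
  The result of an invocation: the account with updated storage (the transfer of
  money is done by \<open>exec_op\<close> below), the emitted operations, and the
  assignment to \<open>fail\<close>.
\<close>

fun invoke ::
  "('c, 'p, 's, 'x, 'm, 'a) any_contract \<Rightarrow> 'c \<Rightarrow> 'p args \<Rightarrow> ('s, 'x, 'm) account \<Rightarrow> bool \<Rightarrow>
     (('s, 'x, 'm) account \<times> ('a, 'p) operation list \<times> bool option) option"
where
  "invoke (Unmonitored C) \<Delta> v r is_first =
     do {
       ((s', x'), ls, fl) \<leftarrow> C \<Delta> v (st r, aux r) (balance r) is_first;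
       Some (r\<lparr>st := s', aux := x'\<rparr>, ls, fl)
     }"
| "invoke (Monitored A) \<Delta> v r is_first =
     do {
       m0 \<leftarrow> (if is_first then m_init A (st r) (balance r) (mon r) else Some (mon r));
       m1 \<leftarrow> m_begin A v m0;
       (s', ls) \<leftarrow> code A \<Delta> v (st r) (balance r);
       m2 \<leftarrow> m_end A ls s' m1;
       Some (r\<lparr>st := s', mon := m2\<rparr>, ls, None)
     }"

definition transfer ::
  "nat \<Rightarrow> 'a \<Rightarrow> 'a \<Rightarrow> ('a, 's, 'x, 'm) ledger \<Rightarrow> ('a, 's, 'x, 'm) ledger"
where
  "transfer n a b \<Sigma> =
     (let \<Sigma>1 = \<Sigma>(a := map_option (\<lambda>r. r\<lparr>balance := balance r - n\<rparr>) (\<Sigma> a))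
      in \<Sigma>1(b := map_option (\<lambda>r. r\<lparr>balance := balance r + n\<rparr>) (\<Sigma>1 b)))"

record ('a, 's, 'x, 'm) txn_state =
  ledger  :: "('a, 's, 'x, 'm) ledger"
  visited :: "'a set"
  failing :: "'a set"  \<comment> \<open>contracts whose flag \<open>fail\<close> is currently true\<close>

fun assign_fail :: "'a \<Rightarrow> bool option \<Rightarrow> 'a set \<Rightarrow> 'a set" where
  "assign_fail a None F = F"
| "assign_fail a (Some True) F = insert a F"
| "assign_fail a (Some False) F = F - {a}"

text \<open>\<^const>\<open>None\<close> means that the operation fails.\<close>

definition exec_op ::
  "('c, 'p, 's, 'x, 'm, 'a) network \<Rightarrow> 'c \<Rightarrow> ('a, 'p) operation \<Rightarrow> ('a, 's, 'x, 'm) txn_state \<Rightarrow>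
     (('a, 's, 'x, 'm) txn_state \<times> ('a, 'p) operation list) option"
where
  "exec_op G \<Delta> o1 \<sigma> =
     do {
       r_src \<leftarrow> ledger \<sigma> (src o1);
       r_dest \<leftarrow> ledger \<sigma> (dest o1);
       C \<leftarrow> G (dest o1);
       if money o1 \<le> balance r_src
       then do {
         (r', ls, fl) \<leftarrow> invoke C \<Delta> (args o1) r_dest (dest o1 \<notin> visited \<sigma>);
         Some (\<lparr>ledger = transfer (money o1) (src o1) (dest o1) ((ledger \<sigma>)(dest o1 \<mapsto> r')),
                visited = insert (dest o1) (visited \<sigma>),
                failing = assign_fail (dest o1) fl (failing \<sigma>)\<rparr>, ls)
       }
       else None
     }"

datatype order = DFS | BFS

fun enqueue :: "order \<Rightarrow> 'o list \<Rightarrow> 'o list \<Rightarrow> 'o list" where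
  "enqueue DFS ls os = ls @ os"
| "enqueue BFS ls os = os @ ls"

text \<open>The check made when the pending list has become empty.\<close>

definition end_ok ::
  "('c, 'p, 's, 'x, 'm, 'a) network \<Rightarrow> ('a, 's, 'x, 'm) txn_state \<Rightarrow> bool"
where
  "end_ok G \<sigma> \<longleftrightarrow>
     failing \<sigma> = {} \<and>
     (\<forall>a A r. a \<in> visited \<sigma> \<longrightarrow> G a = Some (Monitored A) \<longrightarrow> ledger \<sigma> a = Some r \<longrightarrow>
        m_term A (st r) (balance r) (mon r))"

text \<open>
  Besides the new ledger, an outcome records the operations executed in the
  transaction, each with the operations it emitted.
\<close>

type_synonym ('a, 'p) trace = "(('a, 'p) operation \<times> ('a, 'p) operation list) list"

datatype ('a, 'p, 's, 'x, 'm) outcome =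
    Committed "('a, 's, 'x, 'm) ledger" "('a, 'p) trace"
  | Failed "('a, 'p) trace"

fun record_step ::
  "('a, 'p) operation \<times> ('a, 'p) operation list \<Rightarrow> ('a, 'p, 's, 'x, 'm) outcome \<Rightarrow>
     ('a, 'p, 's, 'x, 'm) outcome"
where
  "record_step e (Committed \<Sigma> tr) = Committed \<Sigma> (e # tr)"
| "record_step e (Failed tr) = Failed (e # tr)"

text \<open>A pending list whose execution does not terminate has no outcome.\<close>

inductive exec_pending ::
  "('c, 'p, 's, 'x, 'm, 'a) network \<Rightarrow> order \<Rightarrow> 'c \<Rightarrow> ('a, 's, 'x, 'm) txn_state \<Rightarrow>
     ('a, 'p) operation list \<Rightarrow> ('a, 'p, 's, 'x, 'm) outcome \<Rightarrow> bool"
  for G :: "('c, 'p, 's, 'x, 'm, 'a) network" and ord :: order and \<Delta> :: 'c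
where
  commit: "end_ok G \<sigma> \<Longrightarrow> exec_pending G ord \<Delta> \<sigma> [] (Committed (ledger \<sigma>) [])"
| abort: "\<not> end_ok G \<sigma> \<Longrightarrow> exec_pending G ord \<Delta> \<sigma> [] (Failed [])"
| op_fail: "exec_op G \<Delta> o1 \<sigma> = None \<Longrightarrow> exec_pending G ord \<Delta> \<sigma> (o1 # os) (Failed [])"
| step: "exec_op G \<Delta> o1 \<sigma> = Some (\<sigma>', ls) \<Longrightarrow>
         exec_pending G ord \<Delta> \<sigma>' (enqueue ord ls os) res \<Longrightarrow>
         exec_pending G ord \<Delta> \<sigma> (o1 # os) (record_step (o1, ls) res)"

definition transaction ::
  "('c, 'p, 's, 'x, 'm, 'a) network \<Rightarrow> order \<Rightarrow> 'c \<Rightarrow> ('a, 's, 'x, 'm) ledger \<Rightarrow>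
     ('a, 'p) operation \<Rightarrow> ('a, 'p, 's, 'x, 'm) outcome \<Rightarrow> bool"
where
  "transaction G ord \<Delta> \<Sigma> o1 res \<longleftrightarrow>
     exec_pending G ord \<Delta> \<lparr>ledger = \<Sigma>, visited = {}, failing = {}\<rparr> [o1] res"

fun next_ledger ::
  "('a, 's, 'x, 'm) ledger \<Rightarrow> ('a, 'p, 's, 'x, 'm) outcome \<Rightarrow> ('a, 's, 'x, 'm) ledger"
where
  "next_ledger \<Sigma> (Committed \<Sigma>' tr) = \<Sigma>'"
| "next_ledger \<Sigma> (Failed tr) = \<Sigma>"

text \<open>
  Consecutive transactions, each given by its context and its external operation,
  and their outcomes.
\<close>

inductive history ::
  "('c, 'p, 's, 'x, 'm, 'a) network \<Rightarrow> order \<Rightarrow> ('a, 's, 'x, 'm) ledger \<Rightarrow>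
     ('c \<times> ('a, 'p) operation) list \<Rightarrow> ('a, 'p, 's, 'x, 'm) outcome list \<Rightarrow> bool"
  for G :: "('c, 'p, 's, 'x, 'm, 'a) network" and ord :: order
where
  "history G ord \<Sigma> [] []"
| "transaction G ord \<Delta> \<Sigma> o1 res \<Longrightarrow> history G ord (next_ledger \<Sigma> res) txs ress \<Longrightarrow>
   history G ord \<Sigma> ((\<Delta>, o1) # txs) (res # ress)"

text \<open>
  A contract spends only its own money: the operations it emits have its own
  address as source. External operations are issued by users, not contracts.
\<close>

definition valid_network :: "('c, 'p, 's, 'x, 'm, 'a) network \<Rightarrow> bool" where
  "valid_network G \<longleftrightarrow>
     (\<forall>a C \<Delta> v r is_first r' ls fl.
        G a = Some C \<longrightarrow> invoke C \<Delta> v r is_first = Some (r', ls, fl) \<longrightarrow>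
        (\<forall>o1 \<in> set ls. src o1 = a))"

definition external :: "('c, 'p, 's, 'x, 'm, 'a) network \<Rightarrow> ('a, 'p) operation \<Rightarrow> bool" where
  "external G o1 \<longleftrightarrow> src o1 \<notin> dom G"

text \<open>
  Ledgers that agree except for what is private to the implementation of the
  contract at address \<open>a\<close>: its monitor storage and its auxiliary fields.
\<close>

definition same_ledger ::
  "'a \<Rightarrow> ('a, 's, 'x, 'm) ledger \<Rightarrow> ('a, 's, 'x, 'm) ledger \<Rightarrow> bool"
where
  "same_ledger a \<Sigma> \<Sigma>' \<longleftrightarrow>
     (\<forall>b. b \<noteq> a \<longrightarrow> \<Sigma> b = \<Sigma>' b) \<and>
     rel_option (\<lambda>r r'. st r = st r' \<and> balance r = balance r') (\<Sigma> a) (\<Sigma>' a)"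

fun same_outcome ::
  "'a \<Rightarrow> ('a, 'p, 's, 'x, 'm) outcome \<Rightarrow> ('a, 'p, 's, 'x, 'm) outcome \<Rightarrow> bool"
where
  "same_outcome a (Committed \<Sigma> tr) (Committed \<Sigma>' tr') \<longleftrightarrow> same_ledger a \<Sigma> \<Sigma>' \<and> tr = tr'"
| "same_outcome a (Failed tr) (Failed tr') \<longleftrightarrow> tr = tr'"
| "same_outcome a _ _ \<longleftrightarrow> False"

text \<open>
  \<open>B\<close> can replace \<open>A\<close> in every network, at any address holding \<open>A\<close>, whatever
  (monitored or unmonitored) the other contracts are. The function \<open>ini\<close> gives
  the initial auxiliary fields of \<open>B\<close> from the initial monitor storage of \<open>A\<close>.
\<close>

definition can_replace ::
  "order \<Rightarrow> ('c, 'p, 's, 'm, 'a) monitored_contract \<Rightarrow>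
     ('c, 'p, 's \<times> 'x, 'a) first_fail_contract \<Rightarrow> bool"
where
  "can_replace ord A B \<longleftrightarrow>
     (\<exists>ini :: 'm \<Rightarrow> 'x.
        \<forall>(G :: ('c, 'p, 's, 'x, 'm, 'a) network) a.
          valid_network G \<longrightarrow> G a = Some (Monitored A) \<longrightarrow>
          valid_network (G(a \<mapsto> Unmonitored B)) \<and>
          (\<forall>\<Sigma> \<Sigma>' txs.
             same_ledger a \<Sigma> \<Sigma>' \<longrightarrow>
             (\<forall>r r'. \<Sigma> a = Some r \<longrightarrow> \<Sigma>' a = Some r' \<longrightarrow> aux r' = ini (mon r)) \<longrightarrow>
             (\<forall>(\<Delta>, o1) \<in> set txs. external G o1) \<longrightarrow>
             (\<forall>ress. history G ord \<Sigma> txs ress \<longrightarrow>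
                (\<exists>ress'. history (G(a \<mapsto> Unmonitored B)) ord \<Sigma>' txs ress' \<and>
                         list_all2 (same_outcome a) ress ress')) \<and>
             (\<forall>ress'. history (G(a \<mapsto> Unmonitored B)) ord \<Sigma>' txs ress' \<longrightarrow>
                (\<exists>ress. history G ord \<Sigma> txs ress \<and>
                        list_all2 (same_outcome a) ress ress'))))"

end

theory Submission imports Defs begin

text \<open>
  The replacement \<open>B\<close> runs the three monitor functions inline, detecting the initial call with
  \<open>first\<close>. The obstacle is \<^const>\<open>m_term\<close>, which reads the balance at the end of the transaction
  although \<open>B\<close> may execute for the last time before the operations it emitted are paid for. Since
  only \<open>B\<close> spends its own money, the integer field can hold the balance that will be left once all
  emitted operations have been executed: every invocation adds the received amount and subtracts the
  emitted amounts. \<open>B\<close> assigns to \<open>fail\<close> the verdict of \<^const>\<open>m_term\<close> on this forecast, and the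
  forecast is exact when the pending list is empty.
\<close>

definition inline_monitor ::
  "('c, 'p, 's, 'm, 'a) monitored_contract \<Rightarrow>
     ('c, 'p, 's \<times> ('m \<times> int), 'a) first_fail_contract"
where
  "inline_monitor A \<Delta> v S b is_first =
     do {
       m0 \<leftarrow> (if is_first then m_init A (fst S) b (fst (snd S)) else Some (fst (snd S)));
       m1 \<leftarrow> m_begin A v m0;
       (s', ls) \<leftarrow> code A \<Delta> v (fst S) b;
       m2 \<leftarrow> m_end A ls s' m1;
       let e = (if is_first then int b else snd (snd S)) + int (snd v)
               - int (sum_list (map money ls));
       Some ((s', (m2, e)), ls, Some (\<not> m_term A s' (nat e) m2))
     }"

section \<open>Simulations between runs of two networks\<close>

text \<open>Generalizes \<open>same_outcome\<close> to an arbitrary relation on ledgers. Two things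
  require this: \<open>same_ledger\<close> says nothing about monitor storage and so cannot be
  carried from one transaction to the next, and the backward direction needs the converse
  relation.\<close>

fun outcome_rel ::
  "(('a, 's, 'x, 'm) ledger \<Rightarrow> ('a, 's, 'x, 'm) ledger \<Rightarrow> bool) \<Rightarrow>
     ('a, 'p, 's, 'x, 'm) outcome \<Rightarrow> ('a, 'p, 's, 'x, 'm) outcome \<Rightarrow> bool"
where
  "outcome_rel P (Committed \<Sigma> tr) (Committed \<Sigma>' tr') \<longleftrightarrow> P \<Sigma> \<Sigma>' \<and> tr = tr'"
| "outcome_rel P (Failed tr) (Failed tr') \<longleftrightarrow> tr = tr'"
| "outcome_rel P _ _ \<longleftrightarrow> False"

lemma outcome_rel_record_step:
  "outcome_rel P res res' \<Longrightarrow> outcome_rel P (record_step e res) (record_step e res')"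
  by (cases res; cases res') auto

lemma outcome_rel_flip: "outcome_rel (\<lambda>x y. P y x) res res' \<longleftrightarrow> outcome_rel P res' res"
  by (cases res; cases res') auto

lemma outcome_rel_next_ledger:
  "outcome_rel P res res' \<Longrightarrow> P \<Sigma> \<Sigma>' \<Longrightarrow> P (next_ledger \<Sigma> res) (next_ledger \<Sigma>' res')"
  by (cases res; cases res') auto

text \<open>Induction on the run. \<open>rel_option\<close> pairs failure only with failure, and
  equal emitted lists keep both the traces and the pending lists equal. \<open>R\<close> takes the
  pending list as an argument because the invariant counts the money that list still claims.\<close>

lemma exec_pending_simulation:
  fixes G G' :: "('c, 'p, 's, 'x, 'm, 'a) network"
  assumes run: "exec_pending G ord \<Delta> \<sigma> os res" and "R \<sigma> \<sigma>' os"
    and step_sim: "\<And>\<sigma> \<sigma>' o1 os. R \<sigma> \<sigma>' (o1 # os) \<Longrightarrow>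
      rel_option (\<lambda>(\<tau>, ls) (\<tau>', ls'). ls = ls' \<and> R \<tau> \<tau>' (enqueue ord ls os))
        (exec_op G \<Delta> o1 \<sigma>) (exec_op G' \<Delta> o1 \<sigma>')"
    and end_sim: "\<And>\<sigma> \<sigma>'. R \<sigma> \<sigma>' [] \<Longrightarrow>
      (end_ok G \<sigma> \<longleftrightarrow> end_ok G' \<sigma>') \<and> P (ledger \<sigma>) (ledger \<sigma>')"
  shows "\<exists>res'. exec_pending G' ord \<Delta> \<sigma>' os res' \<and> outcome_rel P res res'"
  using run \<open>R \<sigma> \<sigma>' os\<close>
proof (induction arbitrary: \<sigma>' rule: exec_pending.induct)
  case (commit \<sigma>)
  note end' = end_sim[of \<sigma> \<sigma>', OF commit.prems]
  have "exec_pending G' ord \<Delta> \<sigma>' [] (Committed (ledger \<sigma>') [])"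
    using end' commit.hyps by (intro exec_pending.commit) simp
  then show ?case
    using end' by (intro exI conjI) (assumption, simp)
next
  case (abort \<sigma>)
  have "exec_pending G' ord \<Delta> \<sigma>' [] (Failed [])"
    using end_sim[of \<sigma> \<sigma>', OF abort.prems] abort.hyps by (intro exec_pending.abort) simp
  then show ?case
    by (intro exI conjI) (assumption, simp)
next
  case (op_fail o1 \<sigma> os)
  then have "exec_op G' \<Delta> o1 \<sigma>' = None"
    using step_sim[of \<sigma> \<sigma>' o1 os, OF op_fail.prems] by simp
  then have "exec_pending G' ord \<Delta> \<sigma>' (o1 # os) (Failed [])"
    by (rule exec_pending.op_fail)
  then show ?case
    by (intro exI conjI) (assumption, simp)
next
  case (step o1 \<sigma> \<tau> ls os res)
  obtain \<tau>' where \<tau>': "exec_op G' \<Delta> o1 \<sigma>' = Some (\<tau>', ls)" "R \<tau> \<tau>' (enqueue ord ls os)"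
    using step_sim[of \<sigma> \<sigma>' o1 os, OF step.prems] step.hyps(1) by (auto simp: option_rel_Some1)
  obtain res' where "exec_pending G' ord \<Delta> \<tau>' (enqueue ord ls os) res'" "outcome_rel P res res'"
    using step.IH[OF \<tau>'(2)] by blast
  then show ?case
    by (intro exI conjI) (rule exec_pending.step[OF \<tau>'(1)] outcome_rel_record_step, assumption)+
qed

text \<open>\<open>P\<close> is restored between transactions in either case: a commit yields
  related ledgers, and a failure leaves both starting ledgers in place.\<close>

lemma history_simulation:
  fixes G G' :: "('c, 'p, 's, 'x, 'm, 'a) network"
  assumes run: "history G ord \<Sigma> txs ress" and "P \<Sigma> \<Sigma>'" and "\<forall>(\<Delta>, o1) \<in> set txs. ok o1"
    and transaction_sim: "\<And>\<Delta> \<Sigma> \<Sigma>' o1 res. P \<Sigma> \<Sigma>' \<Longrightarrow> ok o1 \<Longrightarrow> transaction G ord \<Delta> \<Sigma> o1 res \<Longrightarrow>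
      \<exists>res'. transaction G' ord \<Delta> \<Sigma>' o1 res' \<and> outcome_rel P res res'"
  shows "\<exists>ress'. history G' ord \<Sigma>' txs ress' \<and> list_all2 (outcome_rel P) ress ress'"
  using run \<open>P \<Sigma> \<Sigma>'\<close> \<open>\<forall>(\<Delta>, o1) \<in> set txs. ok o1\<close>
proof (induction arbitrary: \<Sigma>' rule: history.induct)
  case (1 \<Sigma>)
  show ?case using history.intros(1) by blast
next
  case (2 \<Delta> \<Sigma> o1 res txs ress)
  obtain res' where res': "transaction G' ord \<Delta> \<Sigma>' o1 res'" "outcome_rel P res res'"
    using transaction_sim[OF 2(4) _ 2(1)] 2(5) by auto
  obtain ress' where "history G' ord (next_ledger \<Sigma>' res') txs ress'"
      "list_all2 (outcome_rel P) ress ress'"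
    using 2(3)[OF outcome_rel_next_ledger[of P, OF res'(2) 2(4)]] 2(5) by auto
  then show ?case
    using history.intros(2)[OF res'(1)] res'(2) by blast
qed

section \<open>Transfers and the money claimed by pending operations\<close>

lemma transfer_apply:
  "transfer n s d \<Sigma> x =
     map_option (\<lambda>r. r\<lparr>balance := balance r - (if x = s then n else 0) + (if x = d then n else 0)\<rparr>)
       (\<Sigma> x)"
  by (cases "\<Sigma> x") (auto simp: transfer_def Let_def)

text \<open>The part of the balance of \<open>a\<close> that is already committed to pending
  operations; the forecast is the balance minus this amount.\<close>

definition owed :: "'a \<Rightarrow> ('a, 'p) operation list \<Rightarrow> nat" where
  "owed a os = (\<Sum>o1\<leftarrow>os. if src o1 = a then money o1 else 0)"

lemma owed_Cons: "owed a (o1 # os) = (if src o1 = a then money o1 else 0) + owed a os"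
  by (simp add: owed_def)

text \<open>A sum ignores the order of the list. This is the only place where the proof
  distinguishes DFS from BFS.\<close>

lemma owed_enqueue: "owed a (enqueue ord ls os) = owed a ls + owed a os"
  by (cases ord) (auto simp: owed_def)

lemma owed_own: "\<forall>o1 \<in> set ls. src o1 = a \<Longrightarrow> owed a ls = sum_list (map money ls)"
  by (induction ls) (auto simp: owed_def)

lemma owed_foreign: "\<forall>o1 \<in> set ls. src o1 \<noteq> a \<Longrightarrow> owed a ls = 0"
  by (induction ls) (auto simp: owed_def)

section \<open>Linked ledgers and the invariant\<close>

text \<open>The relation that persists between transactions. The second component of
  \<open>aux\<close>, the forecast, is left unconstrained: after a transaction it may be stale, and
  the next one recomputes it.\<close>

definition linked ::
  "'a \<Rightarrow> ('a, 's, 'm \<times> int, 'm) ledger \<Rightarrow> ('a, 's, 'm \<times> int, 'm) ledger \<Rightarrow> bool"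
where
  "linked a \<Sigma> \<Sigma>' \<longleftrightarrow>
     (\<forall>b. b \<noteq> a \<longrightarrow> \<Sigma> b = \<Sigma>' b) \<and>
     rel_option (\<lambda>r r'. st r = st r' \<and> balance r = balance r' \<and> mon r = fst (aux r')) (\<Sigma> a) (\<Sigma>' a)"

lemma linkedI:
  assumes same: "same_ledger a \<Sigma> \<Sigma>'"
    and mon: "\<And>r r'. \<Sigma> a = Some r \<Longrightarrow> \<Sigma>' a = Some r' \<Longrightarrow> mon r = fst (aux r')"
  shows "linked a \<Sigma> \<Sigma>'"
  unfolding linked_def
proof
  show "\<forall>b. b \<noteq> a \<longrightarrow> \<Sigma> b = \<Sigma>' b"
    using same unfolding same_ledger_def by blast
  have "rel_option (\<lambda>r r'. st r = st r' \<and> balance r = balance r') (\<Sigma> a) (\<Sigma>' a)"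
    using same unfolding same_ledger_def by blast
  then show "rel_option (\<lambda>r r'. st r = st r' \<and> balance r = balance r' \<and> mon r = fst (aux r'))
      (\<Sigma> a) (\<Sigma>' a)"
    using mon by (cases rule: option.rel_cases) simp_all
qed

lemma linked_other: "linked a \<Sigma> \<Sigma>' \<Longrightarrow> b \<noteq> a \<Longrightarrow> \<Sigma> b = \<Sigma>' b"
  unfolding linked_def by blast

lemma linked_own:
  "linked a \<Sigma> \<Sigma>' \<Longrightarrow>
     rel_option (\<lambda>r r'. st r = st r' \<and> balance r = balance r' \<and> mon r = fst (aux r')) (\<Sigma> a) (\<Sigma>' a)"
  unfolding linked_def by blast

lemma linked_same_ledger: "linked a \<Sigma> \<Sigma>' \<Longrightarrow> same_ledger a \<Sigma> \<Sigma>'"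
  by (auto simp: linked_def same_ledger_def elim: option.rel_mono_strong)

lemma same_outcome_if_linked:
  "outcome_rel (linked a) res res' \<Longrightarrow> same_outcome a res res'"
  by (cases res; cases res') (auto intro: linked_same_ledger)

text \<open>Makes the test for sufficient funds come out the same in both runs, whether or not the
  source is \<open>a\<close>.\<close>

lemma linked_balance:
  assumes "linked a \<Sigma> \<Sigma>'"
  shows "map_option balance (\<Sigma> b) = map_option balance (\<Sigma>' b)"
  using assms by (cases "b = a"; cases "\<Sigma> a"; cases "\<Sigma>' a") (auto simp: linked_def)

text \<open>
  The flag of \<open>a\<close> is compared with the verdict on the forecast, not on the current balance: before the
  pending list is empty the forecast may even be negative.
\<close>

definition sim ::
  "('c, 'p, 's, 'm, 'a) monitored_contract \<Rightarrow> 'a \<Rightarrow> ('a, 's, 'm \<times> int, 'm) txn_state \<Rightarrow>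
     ('a, 's, 'm \<times> int, 'm) txn_state \<Rightarrow> ('a, 'p) operation list \<Rightarrow> bool"
where
  "sim A a \<sigma> \<sigma>' os \<longleftrightarrow>
     linked a (ledger \<sigma>) (ledger \<sigma>') \<and> visited \<sigma>' = visited \<sigma> \<and>
     a \<notin> failing \<sigma> \<and> failing \<sigma>' - {a} = failing \<sigma> \<and>
     (if a \<in> visited \<sigma>
      then \<exists>r r'. ledger \<sigma> a = Some r \<and> ledger \<sigma>' a = Some r' \<and>
             snd (aux r') = int (balance r) - int (owed a os) \<and>
             (a \<in> failing \<sigma>' \<longleftrightarrow> \<not> m_term A (st r) (nat (snd (aux r'))) (mon r))
      else a \<notin> failing \<sigma>' \<and> owed a os = 0)"

text \<open>With no pending operations nothing is owed, so the forecast is the actual balance, and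
  the flag of \<open>a\<close> carries exactly the verdict that \<open>m_term\<close> gives in the
  monitored run.\<close>

lemma sim_end_ok:
  assumes "sim A a \<sigma> \<sigma>' []" and "G a = Some (Monitored A)"
  shows "end_ok G \<sigma> \<longleftrightarrow> end_ok (G(a \<mapsto> Unmonitored B)) \<sigma>'"
proof -
  note S = assms(1)[unfolded sim_def]
  have others: "ledger \<sigma>' b = ledger \<sigma> b" if "b \<noteq> a" for b
    using linked_other[of a "ledger \<sigma>" "ledger \<sigma>'" b] S that by simp
  have vis: "visited \<sigma>' = visited \<sigma>" and fl: "a \<notin> failing \<sigma>" "failing \<sigma>' - {a} = failing \<sigma>"
    using S by blast+
  have flag: "a \<in> failing \<sigma>' \<longleftrightarrow>
      a \<in> visited \<sigma> \<and> (\<forall>r. ledger \<sigma> a = Some r \<longrightarrow> \<not> m_term A (st r) (balance r) (mon r))"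
    using S by (auto simp: owed_def split: if_splits)
  \<comment> \<open>Without an account at \<open>a\<close> the quantifier in \<open>flag\<close>
    would hold vacuously and so would the check of \<open>m_term\<close>, which would contradict
    each other; the invariant excludes this case.\<close>
  have acc: "a \<in> visited \<sigma> \<Longrightarrow> \<exists>r. ledger \<sigma> a = Some r"
    using S by (auto split: if_splits)
  have fe: "failing \<sigma>' = {} \<longleftrightarrow> failing \<sigma> = {} \<and> a \<notin> failing \<sigma>'"
    using fl by blast
  \<comment> \<open>The final check is split by address, so that its instance at \<open>a\<close>
    can be exchanged for the flag while all others agree.\<close>
  define T where "T b \<longleftrightarrow>
      (\<forall>C r. b \<in> visited \<sigma> \<longrightarrow> G b = Some (Monitored C) \<longrightarrow> ledger \<sigma> b = Some r \<longrightarrow>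
        m_term C (st r) (balance r) (mon r))" for b
  have "end_ok G \<sigma> \<longleftrightarrow> failing \<sigma> = {} \<and> (\<forall>b. T b)"
    unfolding end_ok_def T_def by blast
  moreover have "end_ok (G(a \<mapsto> Unmonitored B)) \<sigma>' \<longleftrightarrow>
      failing \<sigma> = {} \<and> a \<notin> failing \<sigma>' \<and> (\<forall>b. b \<noteq> a \<longrightarrow> T b)"
    unfolding end_ok_def T_def fe vis using others by (auto split: if_splits)
  moreover have "a \<notin> failing \<sigma>' \<longleftrightarrow> T a"
    unfolding flag T_def using acc assms(2) by auto
  ultimately show ?thesis by metis
qed

section \<open>Preservation of the invariant by one operation\<close>

text \<open>Both contracts call the same functions on the same arguments, hence fail together. The
  forecast \<open>e\<close> is a function of the emitted list because that list is known only once
  the code has run.\<close>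

lemma invoke_inline_monitor:
  assumes "st r = st r'" "balance r = balance r'" "mon r = fst (aux r')"
    and "e = (\<lambda>ls. (if is_first then int (balance r) else snd (aux r')) + int (snd v)
                   - int (sum_list (map money ls)))"
  shows "invoke (Unmonitored (inline_monitor A)) \<Delta> v r' is_first =
    map_option (\<lambda>(q, ls, _). (r'\<lparr>st := st q, aux := (mon q, e ls)\<rparr>, ls,
        Some (\<not> m_term A (st q) (nat (e ls)) (mon q))))
      (invoke (Monitored A) \<Delta> v r is_first)"
  using assms
  by (auto simp: inline_monitor_def Let_def split: Option.bind_splits prod.splits)

lemma invoke_Monitored_result:
  assumes "invoke (Monitored A) \<Delta> v r is_first = Some (q, ls, fl)"
  shows "balance q = balance r" "fl = None"
  using assms by (auto split: Option.bind_splits prod.splits if_splits)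

lemma exec_op_eq_Some:
  "exec_op G \<Delta> o1 \<sigma> = Some (\<tau>, ls) \<longleftrightarrow>
     (\<exists>rs r C q fl. ledger \<sigma> (src o1) = Some rs \<and> ledger \<sigma> (dest o1) = Some r \<and>
        G (dest o1) = Some C \<and> money o1 \<le> balance rs \<and>
        invoke C \<Delta> (args o1) r (dest o1 \<notin> visited \<sigma>) = Some (q, ls, fl) \<and>
        \<tau> = \<lparr>ledger = transfer (money o1) (src o1) (dest o1) ((ledger \<sigma>)(dest o1 \<mapsto> q)),
             visited = insert (dest o1) (visited \<sigma>),
             failing = assign_fail (dest o1) fl (failing \<sigma>)\<rparr>)"
  unfolding exec_op_def
  by (auto simp: bind_eq_Some_conv split: if_splits)

text \<open>Results need to be matched in one direction only: once \<open>x\<close> is known to be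
  defined, the first premise supplies the related value of \<open>y\<close>.\<close>

lemma rel_optionI:
  assumes "\<And>v. x = Some v \<Longrightarrow> \<exists>w. y = Some w \<and> R v w"
    and "\<And>w. y = Some w \<Longrightarrow> x \<noteq> None"
  shows "rel_option R x y"
  using assms by (cases x; cases y) auto

lemma linked_transfer:
  "linked a \<Sigma> \<Sigma>' \<Longrightarrow> linked a (transfer n s d \<Sigma>) (transfer n s d \<Sigma>')"
  by (cases "\<Sigma> a"; cases "\<Sigma>' a") (auto simp: linked_def transfer_apply)

lemma linked_update_other:
  "linked a \<Sigma> \<Sigma>' \<Longrightarrow> b \<noteq> a \<Longrightarrow> linked a (\<Sigma>(b \<mapsto> q)) (\<Sigma>'(b \<mapsto> q))"
  by (auto simp: linked_def)

lemma linked_update_same: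
  assumes "linked a \<Sigma> \<Sigma>'" "st q = st q'" "balance q = balance q'" "mon q = fst (aux q')"
  shows "linked a (\<Sigma>(a \<mapsto> q)) (\<Sigma>'(a \<mapsto> q'))"
  using assms by (auto simp: linked_def)

lemma mem_assign_fail_other: "d \<noteq> a \<Longrightarrow> a \<in> assign_fail d fl F \<longleftrightarrow> a \<in> F"
  by (induction d fl F rule: assign_fail.induct) auto

lemma assign_fail_Diff:
  "d \<noteq> a \<Longrightarrow> assign_fail d fl F - {a} = assign_fail d fl (F - {a})"
  by (induction d fl F rule: assign_fail.induct) auto

lemma assign_fail_Diff_same: "assign_fail a fl F - {a} = F - {a}"
  by (induction a fl F rule: assign_fail.induct) auto

lemma mem_assign_fail_same: "a \<in> assign_fail a (Some b) F \<longleftrightarrow> b"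
  by (cases b) auto

text \<open>The same contract runs on the same account in both networks. If \<open>a\<close> is the
  source, its balance and its debt drop by the same amount, so the forecast stays exact; the emitted
  operations have another source and add no debt.\<close>

lemma sim_step_other:
  fixes G :: "('c, 'p, 's, 'm \<times> int, 'm, 'a) network"
  assumes valid: "valid_network G" and "dest o1 \<noteq> a" and S: "sim A a \<sigma> \<sigma>' (o1 # os)"
  shows "rel_option (\<lambda>(\<tau>, ls) (\<tau>', ls'). ls = ls' \<and> sim A a \<tau> \<tau>' (enqueue ord ls os))
           (exec_op G \<Delta> o1 \<sigma>) (exec_op (G(a \<mapsto> C')) \<Delta> o1 \<sigma>')"
proof (rule rel_optionI)
  have L: "linked a (ledger \<sigma>) (ledger \<sigma>')" and vis: "visited \<sigma>' = visited \<sigma>"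
    and fl: "a \<notin> failing \<sigma>" "failing \<sigma>' - {a} = failing \<sigma>"
    using S by (auto simp: sim_def)
  have dest_eq: "ledger \<sigma>' (dest o1) = ledger \<sigma> (dest o1)"
    using linked_other[OF L] \<open>dest o1 \<noteq> a\<close> by simp
  note src_eq = linked_balance[OF L, of "src o1"]
  {
    fix w assume "exec_op (G(a \<mapsto> C')) \<Delta> o1 \<sigma>' = Some w"
    then show "exec_op G \<Delta> o1 \<sigma> \<noteq> None"
      using \<open>dest o1 \<noteq> a\<close> dest_eq src_eq vis
      by (cases w; cases "ledger \<sigma> (src o1)") (fastforce simp: exec_op_eq_Some)+
  }
  fix v assume "exec_op G \<Delta> o1 \<sigma> = Some v"
  then obtain \<tau> ls where v: "v = (\<tau>, ls)" and run: "exec_op G \<Delta> o1 \<sigma> = Some (\<tau>, ls)"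
    by (cases v) auto
  obtain rs r C q f where rs: "ledger \<sigma> (src o1) = Some rs" "money o1 \<le> balance rs"
    and r: "ledger \<sigma> (dest o1) = Some r" and C: "G (dest o1) = Some C"
    and inv: "invoke C \<Delta> (args o1) r (dest o1 \<notin> visited \<sigma>) = Some (q, ls, f)"
    and \<tau>: "\<tau> = \<lparr>ledger = transfer (money o1) (src o1) (dest o1) ((ledger \<sigma>)(dest o1 \<mapsto> q)),
             visited = insert (dest o1) (visited \<sigma>),
             failing = assign_fail (dest o1) f (failing \<sigma>)\<rparr>"
    using run unfolding exec_op_eq_Some by blast
  define \<tau>' where "\<tau>' =
      \<lparr>ledger = transfer (money o1) (src o1) (dest o1) ((ledger \<sigma>')(dest o1 \<mapsto> q)),
       visited = insert (dest o1) (visited \<sigma>'),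
       failing = assign_fail (dest o1) f (failing \<sigma>')\<rparr>"
  have run': "exec_op (G(a \<mapsto> C')) \<Delta> o1 \<sigma>' = Some (\<tau>', ls)"
    using rs r C inv \<open>dest o1 \<noteq> a\<close> src_eq dest_eq unfolding exec_op_eq_Some \<tau>'_def vis
    by (auto simp: map_option_case split: option.splits)
  have "owed a ls = 0"
    using valid C inv \<open>dest o1 \<noteq> a\<close> unfolding valid_network_def by (intro owed_foreign) metis
  moreover have "linked a (ledger \<tau>) (ledger \<tau>')"
    unfolding \<tau> \<tau>'_def using L \<open>dest o1 \<noteq> a\<close> by (simp add: linked_transfer linked_update_other)
  \<comment> \<open>The funds test rules out truncated subtraction, so the new balance can be
    computed in the integers.\<close>
  moreover have "src o1 = a \<Longrightarrow> ledger \<sigma> a = Some x \<Longrightarrow> money o1 \<le> balance x" for x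
    using rs by auto
  ultimately have "sim A a \<tau> \<tau>' (enqueue ord ls os)"
    using S fl \<open>dest o1 \<noteq> a\<close> unfolding sim_def
    by (auto simp: \<tau> \<tau>'_def vis mem_assign_fail_other assign_fail_Diff owed_Cons owed_enqueue
        transfer_apply of_nat_diff split: if_splits)
  then show "\<exists>w. exec_op (G(a \<mapsto> C')) \<Delta> o1 \<sigma>' = Some w \<and>
      (case v of (\<tau>, ls) \<Rightarrow> \<lambda>(\<tau>', ls'). ls = ls' \<and> sim A a \<tau> \<tau>' (enqueue ord ls os)) w"
    using run' v by auto
qed

text \<open>The inlined code adds the received amount and subtracts the emitted total, which by
  \<open>valid_network\<close> is exactly the new debt of \<open>a\<close>.\<close>

lemma sim_step_own:
  fixes G :: "('c, 'p, 's, 'm \<times> int, 'm, 'a) network"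
  assumes valid: "valid_network G" and A: "G a = Some (Monitored A)" and [simp]: "dest o1 = a"
    and S: "sim A a \<sigma> \<sigma>' (o1 # os)"
  shows "rel_option (\<lambda>(\<tau>, ls) (\<tau>', ls'). ls = ls' \<and> sim A a \<tau> \<tau>' (enqueue ord ls os))
           (exec_op G \<Delta> o1 \<sigma>) (exec_op (G(a \<mapsto> Unmonitored (inline_monitor A))) \<Delta> o1 \<sigma>')"
    (is "rel_option _ _ (exec_op ?G' _ _ _)")
proof (cases "ledger \<sigma> a")
  case None
  then have "ledger \<sigma>' a = None"
    using S linked_own[of a "ledger \<sigma>" "ledger \<sigma>'"] by (simp add: sim_def)
  then show ?thesis using None by (auto simp: exec_op_def bind_eq_None_conv)
next
  case (Some r)
  have L: "linked a (ledger \<sigma>) (ledger \<sigma>')" and vis: "visited \<sigma>' = visited \<sigma>"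
    and fl: "a \<notin> failing \<sigma>" "failing \<sigma>' - {a} = failing \<sigma>"
    using S by (auto simp: sim_def)
  obtain r' where r': "ledger \<sigma>' a = Some r'" "st r = st r'" "balance r = balance r'"
      "mon r = fst (aux r')"
    using linked_own[OF L] Some by (auto simp: option_rel_Some1)
  note src_eq = linked_balance[OF L, of "src o1"]
  \<comment> \<open>On the first invocation the stored forecast may be left over from an earlier
    transaction, so the current balance takes its place. This is correct because an unvisited
    \<open>a\<close> owes nothing.\<close>
  define e where "e ls = (if a \<notin> visited \<sigma> then int (balance r) else snd (aux r'))
      + int (snd (args o1)) - int (sum_list (map money ls))" for ls :: "('a, 'p) operation list"
  define q' where "q' q ls = r'\<lparr>st := st q, aux := (mon q, e ls)\<rparr>"
    for q :: "('s, 'm \<times> int, 'm) account" and ls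
  define f' where "f' q ls \<longleftrightarrow> \<not> m_term A (st q) (nat (e ls)) (mon q)"
    for q :: "('s, 'm \<times> int, 'm) account" and ls
  have inv': "invoke (Unmonitored (inline_monitor A)) \<Delta> (args o1) r' (a \<notin> visited \<sigma>') =
      map_option (\<lambda>(q, ls, _). (q' q ls, ls, Some (f' q ls)))
        (invoke (Monitored A) \<Delta> (args o1) r (a \<notin> visited \<sigma>))"
    unfolding vis q'_def f'_def by (rule invoke_inline_monitor) (use r' in \<open>auto simp: e_def\<close>)
  show ?thesis
  proof (rule rel_optionI)
    fix w assume "exec_op ?G' \<Delta> o1 \<sigma>' = Some w"
    then obtain rs' q0 f0 where "ledger \<sigma>' (src o1) = Some rs'" "money o1 \<le> balance rs'"
        "invoke (Unmonitored (inline_monitor A)) \<Delta> (args o1) r' (a \<notin> visited \<sigma>') = Some (q0, snd w, f0)"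
      using r'(1) by (cases w) (auto simp: exec_op_eq_Some simp del: invoke.simps)
    then show "exec_op G \<Delta> o1 \<sigma> \<noteq> None"
      using A Some src_eq unfolding inv' by (auto simp: exec_op_def simp del: invoke.simps)
  next
    fix v assume "exec_op G \<Delta> o1 \<sigma> = Some v"
    then obtain \<tau> ls where v: "v = (\<tau>, ls)" and run: "exec_op G \<Delta> o1 \<sigma> = Some (\<tau>, ls)"
      by (cases v) auto
    obtain rs q f where rs: "ledger \<sigma> (src o1) = Some rs" "money o1 \<le> balance rs"
      and inv: "invoke (Monitored A) \<Delta> (args o1) r (a \<notin> visited \<sigma>) = Some (q, ls, f)"
      and \<tau>: "\<tau> = \<lparr>ledger = transfer (money o1) (src o1) a ((ledger \<sigma>)(a \<mapsto> q)),
               visited = insert a (visited \<sigma>), failing = assign_fail a f (failing \<sigma>)\<rparr>"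
      using run A Some unfolding exec_op_eq_Some by auto
    have q: "balance q = balance r" and f: "f = None"
      using invoke_Monitored_result[OF inv] by blast+
    define \<tau>' where "\<tau>' =
        \<lparr>ledger = transfer (money o1) (src o1) a ((ledger \<sigma>')(a \<mapsto> q' q ls)),
         visited = insert a (visited \<sigma>'),
         failing = assign_fail a (Some (f' q ls)) (failing \<sigma>')\<rparr>"
    have run': "exec_op ?G' \<Delta> o1 \<sigma>' = Some (\<tau>', ls)"
      using rs r'(1) inv inv' src_eq unfolding exec_op_eq_Some \<tau>'_def
      by (auto simp: map_option_case simp del: invoke.simps split: option.splits)
    have owed: "owed a ls = sum_list (map money ls)"
      using valid A inv unfolding valid_network_def by (intro owed_own) metis
    have "linked a (ledger \<tau>) (ledger \<tau>')"
      unfolding \<tau> \<tau>'_def using r' q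
      by (auto intro!: linked_transfer linked_update_same L simp: q'_def)
    \<comment> \<open>The forecast equation after the transfer. If \<open>a\<close> pays itself, the
      removed debt and the deduction from the balance cancel, and the received amount is still
      added. On a first invocation the invariant gives zero debt, so a payment from \<open>a\<close>
      can only be of amount 0.\<close>
    moreover have "e ls = int (balance q - (if a = src o1 then money o1 else 0) + money o1)
        - int (owed a (enqueue ord ls os))"
      using S rs Some r' unfolding sim_def
      by (auto simp: e_def q owed owed_Cons owed_enqueue args_def of_nat_diff split: if_splits)
    ultimately have "sim A a \<tau> \<tau>' (enqueue ord ls os)"
      using fl unfolding sim_def
      by (auto simp: \<tau> \<tau>'_def vis f f'_def q'_def r'(3)[symmetric] q mem_assign_fail_same
          assign_fail_Diff_same transfer_apply simp del: assign_fail.simps(2,3))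
    then show "\<exists>w. exec_op ?G' \<Delta> o1 \<sigma>' = Some w \<and>
        (case v of (\<tau>, ls) \<Rightarrow> \<lambda>(\<tau>', ls'). ls = ls' \<and> sim A a \<tau> \<tau>' (enqueue ord ls os)) w"
      using run' v by auto
  qed
qed

section \<open>Transactions, histories and the replacement\<close>

text \<open>The external operation is not paid for by \<open>a\<close>, so the clause of
  \<open>sim\<close> for an unvisited \<open>a\<close> holds at the start.\<close>

lemma sim_initial:
  assumes "linked a \<Sigma> \<Sigma>'" "src o1 \<noteq> a"
  shows "sim A a \<lparr>ledger = \<Sigma>, visited = {}, failing = {}\<rparr>
           \<lparr>ledger = \<Sigma>', visited = {}, failing = {}\<rparr> [o1]"
  using assms by (simp add: sim_def owed_def)

lemma sim_linked: "sim A a \<sigma> \<sigma>' os \<Longrightarrow> linked a (ledger \<sigma>) (ledger \<sigma>')"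
  by (simp add: sim_def)

lemma transaction_inline_monitor:
  fixes G :: "('c, 'p, 's, 'm \<times> int, 'm, 'a) network"
  assumes valid: "valid_network G" and A: "G a = Some (Monitored A)"
    and init: "linked a \<Sigma> \<Sigma>'" "external G o1"
  defines "G' \<equiv> G(a \<mapsto> Unmonitored (inline_monitor A))"
  shows "transaction G ord \<Delta> \<Sigma> o1 res \<Longrightarrow>
      \<exists>res'. transaction G' ord \<Delta> \<Sigma>' o1 res' \<and> outcome_rel (linked a) res res'"
    and "transaction G' ord \<Delta> \<Sigma>' o1 res' \<Longrightarrow>
      \<exists>res. transaction G ord \<Delta> \<Sigma> o1 res \<and> outcome_rel (linked a) res res'"
proof -
  have step: "rel_option (\<lambda>(\<tau>, ls) (\<tau>', ls'). ls = ls' \<and> sim A a \<tau> \<tau>' (enqueue ord ls os))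
           (exec_op G \<Delta> o2 \<sigma>) (exec_op G' \<Delta> o2 \<sigma>')"
    if "sim A a \<sigma> \<sigma>' (o2 # os)" for \<sigma> \<sigma>' o2 os
    using sim_step_own[OF valid A _ that] sim_step_other[OF valid _ that] unfolding G'_def by blast
  have fin: "(end_ok G \<sigma> \<longleftrightarrow> end_ok G' \<sigma>') \<and> linked a (ledger \<sigma>) (ledger \<sigma>')"
    if "sim A a \<sigma> \<sigma>' ([] :: ('a, 'p) operation list)" for \<sigma> \<sigma>'
    using sim_end_ok[of A a \<sigma> \<sigma>' G, OF that A] sim_linked[OF that] unfolding G'_def by blast
  have "src o1 \<noteq> a"
    using init(2) A by (auto simp: external_def)
  note start = sim_initial[OF init(1) this, of A]
  show "\<exists>res'. transaction G' ord \<Delta> \<Sigma>' o1 res' \<and> outcome_rel (linked a) res res'"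
    if "transaction G ord \<Delta> \<Sigma> o1 res"
    using that start step fin unfolding transaction_def
    by (rule exec_pending_simulation)
  \<comment> \<open>The invariant is symmetric in its use: \<open>rel_option\<close> covers
    definedness on both sides, so the converse relation simulates the monitored run from the
    unmonitored one.\<close>
  have step': "rel_option (\<lambda>(\<tau>', ls') (\<tau>, ls). ls' = ls \<and> sim A a \<tau> \<tau>' (enqueue ord ls' os))
           (exec_op G' \<Delta> o2 \<sigma>') (exec_op G \<Delta> o2 \<sigma>)"
    if "sim A a \<sigma> \<sigma>' (o2 # os)" for \<sigma> \<sigma>' o2 os
    using step[OF that] by (subst option.rel_flip[symmetric]) (auto elim: option.rel_mono_strong)
  have "\<exists>res. exec_pending G ord \<Delta> \<lparr>ledger = \<Sigma>, visited = {}, failing = {}\<rparr> [o1] res \<and>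
      outcome_rel (\<lambda>\<Sigma>' \<Sigma>. linked a \<Sigma> \<Sigma>') res' res"
    if "transaction G' ord \<Delta> \<Sigma>' o1 res'"
    by (rule exec_pending_simulation[where R = "\<lambda>\<sigma>' \<sigma> os. sim A a \<sigma> \<sigma>' os",
          OF that[unfolded transaction_def] start])
       (use step' fin in blast)+
  then show "\<exists>res. transaction G ord \<Delta> \<Sigma> o1 res \<and> outcome_rel (linked a) res res'"
    if "transaction G' ord \<Delta> \<Sigma>' o1 res'"
    using that by (simp add: outcome_rel_flip[of "linked a"] transaction_def)
qed

lemma valid_network_inline_monitor:
  fixes G :: "('c, 'p, 's, 'm \<times> int, 'm, 'a) network"
  assumes valid: "valid_network G" and A: "G a = Some (Monitored A)"
  shows "valid_network (G(a \<mapsto> Unmonitored (inline_monitor A)))"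
proof -
  have "\<forall>o1 \<in> set ls. src o1 = a"
    if "invoke (Unmonitored (inline_monitor A)) \<Delta> v r' is_first = Some (q', ls, fl)"
    for \<Delta> v and r' :: "('s, 'm \<times> int, 'm) account" and is_first q' ls fl
  proof -
    \<comment> \<open>Any invocation of the inlined code is mirrored by one of \<open>A\<close> on
      the account whose monitor storage is read off from \<open>aux\<close>. It emits the same list,
      so validity of \<open>G\<close> applies.\<close>
    have "\<exists>q fl'. invoke (Monitored A :: ('c, 'p, 's, 'm \<times> int, 'm, 'a) any_contract) \<Delta> v
        (r'\<lparr>mon := fst (aux r')\<rparr>) is_first = Some (q, ls, fl')"
      using that invoke_inline_monitor[of "r'\<lparr>mon := fst (aux r')\<rparr>" r' _ is_first v A \<Delta>]
      by (auto simp del: invoke.simps)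
    then show ?thesis
      using valid A unfolding valid_network_def by blast
  qed
  then show ?thesis
    using valid unfolding valid_network_def fun_upd_apply by (metis option.inject)
qed

theorem theorem2:
  fixes ord :: order
    and A :: "('c, 'p, 's, 'm, 'a) monitored_contract"
  shows "\<exists>B :: ('c, 'p, 's \<times> ('m \<times> int), 'a) first_fail_contract. can_replace ord A B"
proof
  show "can_replace ord A (inline_monitor A)"
    unfolding can_replace_def
  \<comment> \<open>The 0 is a placeholder: the first invocation in each transaction overwrites the
    forecast.\<close>
  proof (intro exI[of _ "\<lambda>m. (m, 0)"] allI impI conjI)
    fix G :: "('c, 'p, 's, 'm \<times> int, 'm, 'a) network" and a
    assume valid: "valid_network G" and A: "G a = Some (Monitored A)"
    let ?G' = "G(a \<mapsto> Unmonitored (inline_monitor A))"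
    show "valid_network ?G'"
      using valid A by (rule valid_network_inline_monitor)
    fix \<Sigma> \<Sigma>' :: "('a, 's, 'm \<times> int, 'm) ledger" and txs :: "('c \<times> ('a, 'p) operation) list"
    assume same: "same_ledger a \<Sigma> \<Sigma>'"
      and ini: "\<forall>r r'. \<Sigma> a = Some r \<longrightarrow> \<Sigma>' a = Some r' \<longrightarrow> aux r' = (mon r, 0)"
      and ext: "\<forall>(\<Delta>, o1) \<in> set txs. external G o1"
    have L: "linked a \<Sigma> \<Sigma>'"
      by (rule linkedI[OF same]) (metis ini fst_conv)
    note sim = transaction_inline_monitor[of G a A, OF valid A]
    {
      fix ress assume run: "history G ord \<Sigma> txs ress"
      have "\<exists>ress'. history ?G' ord \<Sigma>' txs ress' \<and> list_all2 (outcome_rel (linked a)) ress ress'"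
        by (rule history_simulation[where P = "linked a", OF run L ext]) (rule sim(1))
      then show "\<exists>ress'. history ?G' ord \<Sigma>' txs ress' \<and> list_all2 (same_outcome a) ress ress'"
        by (blast intro: list_all2_mono same_outcome_if_linked)
    next
      fix ress' assume run: "history ?G' ord \<Sigma>' txs ress'"
      \<comment> \<open>The backward direction runs the same simulation with the networks exchanged
        and \<open>linked\<close> reversed; \<open>outcome_rel_flip\<close> turns the result around
        again.\<close>
      have "\<exists>ress. history G ord \<Sigma> txs ress \<and>
          list_all2 (outcome_rel (\<lambda>\<Sigma>' \<Sigma>. linked a \<Sigma> \<Sigma>')) ress' ress"
        by (rule history_simulation[where P = "\<lambda>\<Sigma>' \<Sigma>. linked a \<Sigma> \<Sigma>'", OF run L ext])
           (simp add: outcome_rel_flip[of "linked a"] sim(2))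
      then obtain ress where "history G ord \<Sigma> txs ress"
          "list_all2 (outcome_rel (linked a)) ress ress'"
        by (auto simp: outcome_rel_flip[of "linked a"] list_all2_conv_all_nth)
      then show "\<exists>ress. history G ord \<Sigma> txs ress \<and> list_all2 (same_outcome a) ress ress'"
        by (blast intro: list_all2_mono same_outcome_if_linked)
    }
  qed
qed

end
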